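(* For every integer $n\ge 0$ let $$P_n=P_n(q)=\sum_{i\ge0}\sum_{j\ge0}\sum_{k\ge0}(-1)^{j+k}q^{i^2+j^2+2k}\begin{bmatrix} j\\ i\end{bmatrix}_{q^2}\begin{bmatrix} j+k-1\\ k\end{bmatrix}_{q^2}\begin{bmatrix} n-i-k\\ j\end{bmatrix}_{q^2}.$$ Then for every $n\ge1$, $$P_n=\sum_{j=-\infty}^\infty(-1)^jq^{j^2}\,U(n-1,j;q),$$ and $P_0=1$, $P_1=-q+1$, and $P_n=(1-q^2-q^{2n-1})P_{n-1}+(q^2-q^{2n-2})P_{n-2}$ for $n\ge2$.
   Context: $q$ is an indeterminate. $(a;p)_n=\prod_{i=0}^{n-1}(1-ap^i)$. The Gaussian polynomial in base $p$ is $\begin{bmatrix} A\\ B\end{bmatrix}_{p}=\frac{(p;p)_A}{(p;p)_B(p;p)_{A-B}}$ if $0\le B\le A$, and $0$ otherwise; the only exception is that the factor $\begin{bmatrix} j+k-1\\ k\end{bmatrix}_{q^2}$ is taken to be $1$ when $j=k=0$. For integers $L\ge0$ and $A$, $$T_0(L,A;q)=\sum_{r=0}^L(-1)^r\begin{bmatrix} L\\ r\end{bmatrix}_{q^2}\begin{bmatrix} 2L-2r\\ L-A-r\end{bmatrix}_{q},\qquad U(L,A;q)=T_0(L,A;q)+T_0(L,A+1;q).$$ All sums have only finitely many nonzero terms. *)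

theory Defs
  imports
    "HOL-Computational_Algebra.Computational_Algebra"
    "HOL-Library.Groups_Big_Fun"
begin

text \<open>
  The indeterminate lives in the field of fractions of the integer polynomials, so that the
  quotients defining the Gaussian polynomials are genuine divisions.
\<close>

definition qvar :: "int poly fract" where
  "qvar = Fract [:0, 1:] 1"

definition qpoch :: "'a::comm_ring_1 \<Rightarrow> 'a \<Rightarrow> nat \<Rightarrow> 'a" where
  "qpoch a p n = (\<Prod>i<n. 1 - a * p ^ i)"

lemma qvar_power_neq_1:
  assumes "m > 0"
  shows "qvar ^ m \<noteq> 1"
proof -
  have *: "qvar ^ m = Fract (monom 1 m) 1"
    by (induction m) (simp_all add: qvar_def One_fract_def monom_Suc pCons_one flip: one_pCons)
  show ?thesis
  proof
    assume "qvar ^ m = 1"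
    then have "monom (1::int) m = 1" by (simp add: * One_fract_def eq_fract)
    then have "degree (monom (1::int) m) = 0" by simp
    with assms show False by (simp add: degree_monom_eq)
  qed
qed

text \<open>
  Hence no denominator vanishes in the bases \<open>q\<close> and \<open>q\<^sup>2\<close>.
\<close>

lemma qpoch_qvar_nonzero:
  assumes "e > 0"
  shows "qpoch (qvar ^ e) (qvar ^ e) n \<noteq> 0"
proof -
  have "qvar ^ e * (qvar ^ e) ^ i \<noteq> 1" for i
    using qvar_power_neq_1[of "e + e * i"] assms by (simp add: power_add power_mult)
  then show ?thesis by (auto simp: qpoch_def)
qed

text \<open>
  The entries are integers because arguments such as \<open>n - i - k\<close> may be negative.
\<close>

definition gauss_poly :: "'a::field \<Rightarrow> int \<Rightarrow> int \<Rightarrow> 'a" where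
  "gauss_poly p A B =
     (if 0 \<le> B \<and> B \<le> A
      then qpoch p p (nat A) / (qpoch p p (nat B) * qpoch p p (nat (A - B)))
      else 0)"

definition T0 :: "nat \<Rightarrow> int \<Rightarrow> 'a::field \<Rightarrow> 'a" where
  "T0 L A q =
     (\<Sum>r=0..L. (-1) ^ r * gauss_poly (q\<^sup>2) (int L) (int r)
        * gauss_poly q (2 * int L - 2 * int r) (int L - A - int r))"

definition U_poly :: "nat \<Rightarrow> int \<Rightarrow> 'a::field \<Rightarrow> 'a" where
  "U_poly L A q = T0 L A q + T0 L (A + 1) q"

definition P_term :: "nat \<Rightarrow> 'a::field \<Rightarrow> nat \<Rightarrow> nat \<Rightarrow> nat \<Rightarrow> 'a" where
  "P_term n q i j k =
     (-1) ^ (j + k) * q ^ (i\<^sup>2 + j\<^sup>2 + 2 * k)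
       * gauss_poly (q\<^sup>2) (int j) (int i)
       * (if j = 0 \<and> k = 0 then 1 else gauss_poly (q\<^sup>2) (int j + int k - 1) (int k))
       * gauss_poly (q\<^sup>2) (int n - int i - int k) (int j)"

text \<open>
  \<^const>\<open>Sum_any\<close> is the sum over the support, and is zero if the support is infinite.
  The lemmas below show that the supports occurring here are finite.
\<close>

definition P_poly :: "nat \<Rightarrow> 'a::field \<Rightarrow> 'a" where
  "P_poly n q = Sum_any (\<lambda>i. Sum_any (\<lambda>j. Sum_any (\<lambda>k. P_term n q i j k)))"

lemma P_term_support: "P_term n q i j k \<noteq> 0 \<Longrightarrow> i + j + k \<le> n"
  by (auto simp: P_term_def gauss_poly_def split: if_splits)

lemma P_poly_eq_finite_sum: "P_poly n q = (\<Sum>i\<le>n. \<Sum>j\<le>n. \<Sum>k\<le>n. P_term n q i j k)"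
proof -
  have zero: "P_term n q i j k = 0" if "i > n \<or> j > n \<or> k > n" for i j k
    using P_term_support[of n q i j k] that by fastforce
  have 1: "Sum_any (\<lambda>k. P_term n q i j k) = (\<Sum>k\<le>n. P_term n q i j k)" for i j
    by (rule Sum_any.expand_superset) (use zero in \<open>force simp: not_less\<close>)+
  have 2: "Sum_any (\<lambda>j. \<Sum>k\<le>n. P_term n q i j k) = (\<Sum>j\<le>n. \<Sum>k\<le>n. P_term n q i j k)" for i
    by (rule Sum_any.expand_superset) (auto simp: zero intro: ccontr)
  show ?thesis unfolding P_poly_def 1 2
    by (rule Sum_any.expand_superset) (auto simp: zero intro: ccontr)
qed

lemma T0_support: "T0 L A q \<noteq> 0 \<Longrightarrow> \<bar>A\<bar> \<le> int L"
proof (rule ccontr)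
  assume "T0 L A q \<noteq> 0" and "\<not> \<bar>A\<bar> \<le> int L"
  then have "T0 L A q = 0"
    unfolding T0_def by (intro sum.neutral) (auto simp: gauss_poly_def)
  with \<open>T0 L A q \<noteq> 0\<close> show False by simp
qed

lemma finite_U_poly_support: "finite {j. (-1) powi j * q powi (j\<^sup>2) * U_poly L j q \<noteq> 0}"
proof (rule finite_subset)
  show "{j. (-1) powi j * q powi (j\<^sup>2) * U_poly L j q \<noteq> 0} \<subseteq> {- int L - 1..int L}"
  proof
    fix j assume "j \<in> {j. (-1) powi j * q powi (j\<^sup>2) * U_poly L j q \<noteq> 0}"
    then have "T0 L j q \<noteq> 0 \<or> T0 L (j + 1) q \<noteq> 0" by (auto simp: U_poly_def)
    then show "j \<in> {- int L - 1..int L}"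
      using T0_support[of L j q] T0_support[of L "j + 1" q] by auto
  qed
qed simp

end

theory Submission
  imports Defs
begin

text \<open>
  Write \<open>p = q\<^sup>2\<close>, let \<open>D\<close> be the dilation \<open>f(x) \<mapsto> f(p x)\<close> of power series, and write
  \<open>[A, B]\<close> for a Gaussian polynomial in base \<open>q\<close>. Both sides of the identity are shown to satisfy
  the same second-order recurrence with the same initial values.

  \<^bold>\<open>The triple sum.\<close> Fix \<open>j\<close>. The last Gaussian factor depends on \<open>n - i - k\<close>, so the generating
  function in \<open>n\<close> of the terms with this \<open>j\<close> is a product of three one-variable series. By the
  \<open>q\<close>-binomial theorem it is
  \<open>f\<^sub>j = (-1)\<^sup>j q\<^bsup>j\<^sup>2\<^esup> x\<^sup>j (-xq; p)\<^sub>j / ((x; p)\<^bsub>j+1\<^esub> (-xp; p)\<^sub>j)\<close>. Without passing through this closed form,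
  Pascal's rule for each of the three factors gives
  \<open>(1 - x)(1 + p x) f\<^bsub>j+1\<^esub> = - q x (1 + q x) D f\<^sub>j\<close> (lemma \<open>P_slice_Suc\<close>), while
  \<open>f\<^sub>0 = 1 / (1 - x)\<close>. Summing over \<open>j\<close> gives
  \<open>(1 - x)(1 + p x) F = 1 + p x - q x (1 + q x) D F\<close> for \<open>F = \<Sum>\<^sub>n P\<^sub>n x\<^sup>n\<close>, and its coefficients are the
  initial values and the recurrence.

  \<^bold>\<open>The series over the integers.\<close> Exchanging the sums over \<open>j\<close> and \<open>r\<close> reduces
  \<open>S\<^sub>L = \<Sum>\<^sub>j (-1)\<^sup>j q\<^bsup>j\<^sup>2\<^esup> U(L, j; q)\<close> to the alternating sums
  \<open>A\<^sub>N = \<Sum>\<^sub>j (-1)\<^sup>j q\<^bsup>j\<^sup>2\<^esup> [2N, N - j]\<close> and \<open>B\<^sub>N = \<Sum>\<^sub>j (-1)\<^sup>j q\<^bsup>j\<^sup>2\<^esup> [2N, N - 1 - j]\<close>. The two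
  forms of Pascal's rule, together with the vanishing of one odd sum under a reflection, give
  \<open>A\<^sub>N = (q; p)\<^sub>N\<close>, which is Gauss's evaluation with \<open>1 / q\<close> for \<open>q\<close>, and \<open>B\<^sub>N = (1 - p\<^sup>N - q p\<^sup>N) A\<^sub>N\<close> (lemmas \<open>A_eq\<close> and
  \<open>B_eq\<close>). Hence \<open>G = \<Sum>\<^sub>L S\<^sub>L x\<^sup>L / (p; p)\<^sub>L\<close> is a product of series with simple dilation
  equations, and \<open>(1 - x)(1 + p x) G = (1 - q\<^sup>3 x) D G\<close> (lemma \<open>U_gf_dilate\<close>). Its coefficients are the
  recurrence again, with \<open>S\<^sub>n\<close> in the place of \<open>P\<^bsub>n+1\<^esub>\<close>.
\<close>

section \<open>Gaussian polynomials\<close>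

lemma qpoch_0 [simp]: "qpoch a p 0 = 1"
  by (simp add: qpoch_def)

lemma qpoch_Suc: "qpoch a p (Suc n) = qpoch a p n * (1 - a * p ^ n)"
  by (simp add: qpoch_def)

lemma qpoch_self_nonzero:
  fixes p :: "'a::field"
  assumes "\<And>m. m > 0 \<Longrightarrow> p ^ m \<noteq> 1"
  shows "qpoch p p n \<noteq> 0"
  using assms[of "Suc i" for i] by (auto simp: qpoch_def)

lemma gauss_poly_outside: "B < 0 \<or> A < B \<Longrightarrow> gauss_poly p A B = 0"
  by (auto simp: gauss_poly_def)

lemma gauss_poly_symmetric: "gauss_poly p A (A - B) = gauss_poly p A B"
  by (auto simp: gauss_poly_def mult.commute)

lemma gauss_poly_nat:
  "r \<le> L \<Longrightarrow> gauss_poly p (int L) (int r) = qpoch p p L / (qpoch p p r * qpoch p p (L - r))"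
  by (auto simp: gauss_poly_def simp flip: of_nat_diff)

lemma gauss_poly_0_right:
  assumes "\<And>m. m > 0 \<Longrightarrow> p ^ m \<noteq> 1" "A \<ge> 0"
  shows "gauss_poly p A 0 = 1"
  using assms(2) qpoch_self_nonzero[OF assms(1)] by (simp add: gauss_poly_def)

lemma gauss_poly_self:
  assumes "\<And>m. m > 0 \<Longrightarrow> p ^ m \<noteq> 1" "A \<ge> 0"
  shows "gauss_poly p A A = 1"
  using assms(2) qpoch_self_nonzero[OF assms(1)] by (simp add: gauss_poly_def)

lemma gauss_poly_Pascal:
  fixes p :: "'a::field"
  assumes p: "\<And>m. m > 0 \<Longrightarrow> p ^ m \<noteq> 1" and A: "A \<ge> 0"
  shows "gauss_poly p (A + 1) B = gauss_poly p A (B - 1) + p powi B * gauss_poly p A B"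
proof -
  note nz = qpoch_self_nonzero[OF p]
  consider "B < 0 \<or> A + 1 < B" | "B = 0" | "B = A + 1" | "1 \<le> B" "B \<le> A"
    by linarith
  then show ?thesis
  proof cases
    case 1
    then show ?thesis by (auto simp: gauss_poly_outside)
  next
    case 2
    then show ?thesis using A by (simp add: gauss_poly_0_right[OF p] gauss_poly_outside)
  next
    case 3
    then show ?thesis using A by (simp add: gauss_poly_self[OF p] gauss_poly_outside)
  next
    case 4
    define b where "b = nat (B - 1)"
    define c where "c = nat (A - B)"
    have B: "B = int (Suc b)" and A': "A = int (Suc (b + c))"
      using 4 by (auto simp: b_def c_def)
    have args: "nat (A + 1) = Suc (Suc (b + c))" "nat A = Suc (b + c)" "nat B = Suc b"
      "nat (B - 1) = b" "nat (A + 1 - B) = Suc c" "nat (A - B) = c" "nat (A - (B - 1)) = Suc c"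
      by (auto simp: A' B)
    have f: "1 - p * p ^ b \<noteq> 0" "1 - p * p ^ c \<noteq> 0"
      using p[of "Suc b"] p[of "Suc c"] by auto
    have powi: "p powi B = p * p ^ b"
      unfolding B power_int_of_nat by simp
    have in_range: "0 \<le> B \<and> B \<le> A + 1" "0 \<le> B - 1 \<and> B - 1 \<le> A" "0 \<le> B \<and> B \<le> A"
      using 4 by auto
    show ?thesis
      unfolding gauss_poly_def if_P[OF in_range(1)] if_P[OF in_range(2)] if_P[OF in_range(3)]
        args powi qpoch_Suc
      using f nz[of b] nz[of c]
      by (simp add: divide_simps) (simp add: algebra_simps power_add)
  qed
qed

lemma gauss_poly_Pascal':
  fixes p :: "'a::field"
  assumes p: "\<And>m. m > 0 \<Longrightarrow> p ^ m \<noteq> 1" and A: "A \<ge> 0"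
  shows "gauss_poly p (A + 1) B = p powi (A + 1 - B) * gauss_poly p A (B - 1) + gauss_poly p A B"
proof -
  have "gauss_poly p (A + 1) B = gauss_poly p (A + 1) (A + 1 - B)"
    by (simp add: gauss_poly_symmetric)
  also have "\<dots> = gauss_poly p A (A - B) + p powi (A + 1 - B) * gauss_poly p A (A - (B - 1))"
    using gauss_poly_Pascal[OF p A, of "A + 1 - B"] by (simp add: algebra_simps)
  finally show ?thesis
    by (simp only: gauss_poly_symmetric add.commute)
qed

section \<open>Dilated power series and the generic parameter\<close>

definition dilate :: "'a::field \<Rightarrow> 'a fps \<Rightarrow> 'a fps" where
  "dilate c f = fps_compose f (fps_const c * fps_X)"

lemma dilate_nth [simp]: "dilate c f $ n = c ^ n * f $ n"
  by (simp add: dilate_def fps_compose_linear)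

lemma dilate_mult: "dilate c (f * g) = dilate c f * dilate c g"
  by (simp add: dilate_def fps_compose_mult_distrib)

lemma dilate_const: "dilate c (fps_const x) = fps_const x"
  by (simp add: dilate_def)

lemma dilate_sum: "dilate c (\<Sum>j\<in>A. f j) = (\<Sum>j\<in>A. dilate c (f j))"
  by (rule fps_ext) (simp add: fps_sum_nth sum_distrib_left)

text \<open>
  The argument works for any nonzero \<open>q\<close> at which no denominator vanishes. The assumption on \<open>2\<close>
  is there because one sum is shown to vanish by being equal to its own negative.
\<close>

locale generic_q =
  fixes q :: "'a::field"
  assumes q_nonzero: "q \<noteq> 0"
    and not_root_of_unity: "m > 0 \<Longrightarrow> q ^ m \<noteq> 1"
    and two_nonzero: "(2 :: 'a) \<noteq> 0"
begin

lemma not_root_of_unity_sq: "m > 0 \<Longrightarrow> (q\<^sup>2) ^ m \<noteq> 1"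
  using not_root_of_unity[of "2 * m"] by (simp add: power_mult)

lemmas Pascal = gauss_poly_Pascal[OF not_root_of_unity]
lemmas Pascal' = gauss_poly_Pascal'[OF not_root_of_unity]
lemmas Pascal_sq = gauss_poly_Pascal[OF not_root_of_unity_sq]
lemmas Pascal_sq' = gauss_poly_Pascal'[OF not_root_of_unity_sq]
lemmas qpoch_sq_nonzero = qpoch_self_nonzero[OF not_root_of_unity_sq]

section \<open>The recurrence for the triple sum\<close>

text \<open>
  The next three series carry the dependence of a term of the triple sum on \<open>i\<close>, on \<open>k\<close>, and on
  \<open>m = n - i - k\<close>.
\<close>

definition i_series :: "nat \<Rightarrow> 'a fps" where
  "i_series j = Abs_fps (\<lambda>i. q ^ i\<^sup>2 * gauss_poly (q\<^sup>2) (int j) (int i))"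

definition k_series :: "nat \<Rightarrow> 'a fps" where
  "k_series j = Abs_fps (\<lambda>k. (-1) ^ k * q ^ (2 * k) *
     (if j = 0 \<and> k = 0 then 1 else gauss_poly (q\<^sup>2) (int j + int k - 1) (int k)))"

definition n_series :: "nat \<Rightarrow> 'a fps" where
  "n_series j = Abs_fps (\<lambda>m. gauss_poly (q\<^sup>2) (int m) (int j))"

definition P_slice :: "nat \<Rightarrow> 'a fps" where
  "P_slice j = fps_const ((-1) ^ j * q ^ j\<^sup>2) * (i_series j * (k_series j * n_series j))"

lemma i_series_Suc: "i_series (Suc j) = (1 + fps_const q * fps_X) * dilate (q\<^sup>2) (i_series j)"
proof (rule fps_ext)
  fix i
  show "i_series (Suc j) $ i = ((1 + fps_const q * fps_X) * dilate (q\<^sup>2) (i_series j)) $ i"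
  proof (cases i)
    case 0
    then show ?thesis
      by (simp add: i_series_def gauss_poly_0_right[OF not_root_of_unity_sq] algebra_simps)
  next
    case (Suc l)
    have "gauss_poly (q\<^sup>2) (int j + 1) (int (Suc l))
        = gauss_poly (q\<^sup>2) (int j) (int l) + (q\<^sup>2) ^ Suc l * gauss_poly (q\<^sup>2) (int j) (int (Suc l))"
      using Pascal_sq[of "int j" "int (Suc l)"] unfolding power_int_of_nat by simp
    moreover have "q ^ (Suc l)\<^sup>2 = q ^ l\<^sup>2 * (q\<^sup>2) ^ l * q"
      by (simp add: power2_eq_square power_add power_mult_distrib)
    ultimately show ?thesis
      using Suc by (simp add: i_series_def algebra_simps)
  qed
qed

lemma k_series_Suc:
  "(1 + fps_const (q\<^sup>2) * fps_X) * k_series (Suc j) = dilate (q\<^sup>2) (k_series j)"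
proof (rule fps_ext)
  fix k
  show "((1 + fps_const (q\<^sup>2) * fps_X) * k_series (Suc j)) $ k = dilate (q\<^sup>2) (k_series j) $ k"
  proof (cases k)
    case 0
    then show ?thesis
      by (simp add: k_series_def gauss_poly_0_right[OF not_root_of_unity_sq] algebra_simps)
  next
    case (Suc l)
    have "gauss_poly (q\<^sup>2) (int j + int l + 1) (int (Suc l))
        = gauss_poly (q\<^sup>2) (int j + int l) (int l)
          + (q\<^sup>2) ^ Suc l * gauss_poly (q\<^sup>2) (int j + int l) (int (Suc l))"
      using Pascal_sq[of "int j + int l" "int (Suc l)"] unfolding power_int_of_nat by simp
    then show ?thesis
      using Suc by (simp add: k_series_def algebra_simps power_mult)
  qed
qed

lemma n_series_Suc:
  "fps_const ((q\<^sup>2) ^ j) * ((1 - fps_X) * n_series (Suc j)) = fps_X * dilate (q\<^sup>2) (n_series j)"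
proof (rule fps_ext)
  fix n
  show "(fps_const ((q\<^sup>2) ^ j) * ((1 - fps_X) * n_series (Suc j))) $ n
      = (fps_X * dilate (q\<^sup>2) (n_series j)) $ n"
  proof (cases n)
    case 0
    then show ?thesis
      by (simp add: n_series_def gauss_poly_outside algebra_simps)
  next
    case (Suc m)
    have "gauss_poly (q\<^sup>2) (int m + 1) (int j + 1)
        = (q\<^sup>2) powi (int m - int j) * gauss_poly (q\<^sup>2) (int m) (int j)
          + gauss_poly (q\<^sup>2) (int m) (int j + 1)"
      using Pascal_sq'[of "int m" "int j + 1"] by simp
    moreover have "(q\<^sup>2) ^ j * (q\<^sup>2) powi (int m - int j) = (q\<^sup>2) ^ m"
      using q_nonzero by (simp add: power_int_diff)
    ultimately show ?thesis
      using Suc by (simp add: n_series_def algebra_simps)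
  qed
qed

text \<open>
  The dilation acts on the three factors of a slice simultaneously. The factors \<open>1 + q x\<close>,
  \<open>1 + p x\<close> and \<open>(1 - x) / x\<close> come from the \<open>i\<close>-, \<open>k\<close>- and \<open>m\<close>-series, and the power of \<open>p\<close> in the rule for
  the last one is absorbed by \<open>q\<^bsup>(j+1)\<^sup>2\<^esup> = q\<^bsup>j\<^sup>2\<^esup> q p\<^sup>j\<close>.
\<close>

lemma P_slice_Suc:
  "(1 - fps_X) * (1 + fps_const (q\<^sup>2) * fps_X) * P_slice (Suc j)
   = - (fps_const q * fps_X * (1 + fps_const q * fps_X) * dilate (q\<^sup>2) (P_slice j))"
proof -
  have c: "(-1) ^ Suc j * q ^ (Suc j)\<^sup>2 = ((-1) ^ j * q ^ j\<^sup>2) * (- q) * (q\<^sup>2) ^ j"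
    by (simp add: power2_eq_square power_add power_mult_distrib)
  have "(1 - fps_X) * (1 + fps_const (q\<^sup>2) * fps_X) * P_slice (Suc j)
     = fps_const ((-1) ^ j * q ^ j\<^sup>2) * fps_const (- q) * i_series (Suc j)
       * ((1 + fps_const (q\<^sup>2) * fps_X) * k_series (Suc j))
       * (fps_const ((q\<^sup>2) ^ j) * ((1 - fps_X) * n_series (Suc j)))"
    unfolding P_slice_def c fps_const_mult[symmetric] by (simp only: mult_ac)
  also have "\<dots> = fps_const (- q) * fps_X * (1 + fps_const q * fps_X) * dilate (q\<^sup>2) (P_slice j)"
    unfolding k_series_Suc n_series_Suc i_series_Suc P_slice_def dilate_mult dilate_const
    by (simp only: mult_ac)
  finally show ?thesis
    by (simp flip: fps_const_neg)
qed

lemma P_slice_0: "(1 - fps_X) * P_slice 0 = 1"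
proof -
  have "i_series 0 = 1"
    by (rule fps_ext)
      (auto simp: i_series_def gauss_poly_outside gauss_poly_0_right[OF not_root_of_unity_sq])
  moreover have "k_series 0 = 1"
    by (rule fps_ext) (auto simp: k_series_def gauss_poly_outside)
  moreover have "n_series 0 = Abs_fps (\<lambda>_. 1)"
    by (rule fps_ext) (auto simp: n_series_def gauss_poly_0_right[OF not_root_of_unity_sq])
  moreover have "(1 - fps_X) * Abs_fps (\<lambda>_. 1 :: 'a) = 1"
    by (rule fps_ext) (simp add: left_diff_distrib)
  ultimately show ?thesis
    by (simp add: P_slice_def)
qed

lemma P_slice_nth: "P_slice j $ n = (\<Sum>i\<le>n. \<Sum>k\<le>n. P_term n q i j k)"
proof -
  have slice_term: "(-1) ^ j * q ^ j\<^sup>2 * (i_series j $ i * (k_series j $ k * n_series j $ (n - i - k)))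
      = P_term n q i j k" if "i \<le> n" "k \<le> n - i" for i k
  proof -
    have "int n - int i - int k = int (n - i - k)"
      using that by simp
    moreover have "q ^ (i\<^sup>2 + j\<^sup>2 + 2 * k) = q ^ j\<^sup>2 * q ^ i\<^sup>2 * q ^ (2 * k)"
      by (simp add: power_add)
    moreover have "(-1 :: 'a) ^ (j + k) = (-1) ^ j * (-1) ^ k"
      by (rule power_add)
    ultimately show ?thesis
      by (simp only: P_term_def i_series_def k_series_def n_series_def fps_nth_Abs_fps mult_ac)
  qed
  have "P_slice j $ n = (-1) ^ j * q ^ j\<^sup>2 * (\<Sum>i\<le>n. i_series j $ i *
      (\<Sum>k\<le>n - i. k_series j $ k * n_series j $ (n - i - k)))"
    unfolding P_slice_def fps_mult_left_const_nth unfolding fps_mult_nth atMost_atLeast0 ..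
  also have "\<dots> = (\<Sum>i\<le>n. \<Sum>k\<le>n - i. (-1) ^ j * q ^ j\<^sup>2 *
      (i_series j $ i * (k_series j $ k * n_series j $ (n - i - k))))"
    unfolding sum_distrib_left ..
  also have "\<dots> = (\<Sum>i\<le>n. \<Sum>k\<le>n - i. P_term n q i j k)"
    by (intro sum.cong[OF refl] slice_term) simp_all
  also have "\<dots> = (\<Sum>i\<le>n. \<Sum>k\<le>n. P_term n q i j k)"
    by (intro sum.cong refl sum.mono_neutral_left) (use P_term_support[of n q] in fastforce)+
  finally show ?thesis .
qed

lemma P_slice_nth_eq_0: "n < j \<Longrightarrow> P_slice j $ n = 0"
  unfolding P_slice_nth using P_term_support[of n q] by (intro sum.neutral ballI) fastforce

lemma P_poly_eq_sum_slices:
  assumes "n \<le> m"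
  shows "P_poly n q = (\<Sum>j\<le>m. P_slice j) $ n"
proof -
  have "P_poly n q = (\<Sum>j\<le>n. P_slice j $ n)"
    unfolding P_poly_eq_finite_sum P_slice_nth by (rule sum.swap)
  also have "\<dots> = (\<Sum>j\<le>m. P_slice j $ n)"
    using assms by (intro sum.mono_neutral_left) (auto simp: P_slice_nth_eq_0)
  finally show ?thesis by (simp add: fps_sum_nth)
qed

text \<open>
  Partial sums avoid a limit: the coefficient at \<open>n\<close> is already final once \<open>m \<ge> n\<close>.
\<close>

lemma sum_slices:
  "(1 - fps_X) * (1 + fps_const (q\<^sup>2) * fps_X) * (\<Sum>j\<le>Suc m. P_slice j)
   = 1 + fps_const (q\<^sup>2) * fps_X
     - fps_const q * fps_X * (1 + fps_const q * fps_X) * dilate (q\<^sup>2) (\<Sum>j\<le>m. P_slice j)"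
proof -
  have "(1 - fps_X) * (1 + fps_const (q\<^sup>2) * fps_X) * (\<Sum>j\<le>Suc m. P_slice j)
     = (1 + fps_const (q\<^sup>2) * fps_X) * ((1 - fps_X) * P_slice 0)
       + (\<Sum>j\<le>m. (1 - fps_X) * (1 + fps_const (q\<^sup>2) * fps_X) * P_slice (Suc j))"
    unfolding sum.atMost_Suc_shift distrib_left[of "_ * _"] sum_distrib_left by (simp only: mult_ac)
  then show ?thesis
    unfolding P_slice_0 P_slice_Suc dilate_sum by (simp add: sum_distrib_left sum_negf)
qed

lemma quadratic_mult_nth:
  fixes a :: 'a
  shows "((1 - fps_X) * (1 + fps_const a * fps_X) * f) $ n
       = f $ n - (if n = 0 then 0 else (1 - a) * f $ (n - 1))
         - (if n < 2 then 0 else a * f $ (n - 2))"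
proof -
  have "(1 - fps_X) * (1 + fps_const a * fps_X) * f
      = f - fps_const (1 - a) * (fps_X * f) - fps_const a * (fps_X * (fps_X * f))"
    unfolding fps_const_sub[symmetric] fps_const_1_eq_1 by (simp add: algebra_simps)
  then show ?thesis by (auto simp: numeral_2_eq_2)
qed

text \<open>
  Coefficient extraction from the functional equation; the three cases \<open>n = 0\<close>, \<open>n = 1\<close> and
  \<open>n \<ge> 2\<close> yield the two initial values and the recurrence.
\<close>

lemma P_poly_recurrence_general:
  "P_poly n q - (if n = 0 then 0 else (1 - q\<^sup>2) * P_poly (n - 1) q)
     - (if n < 2 then 0 else q\<^sup>2 * P_poly (n - 2) q)
   = (if n = 0 then 1 else if n = 1 then q\<^sup>2 else 0)
     - (if n = 0 then 0 else q * (q\<^sup>2) ^ (n - 1) * P_poly (n - 1) q)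
     - (if n < 2 then 0 else q\<^sup>2 * (q\<^sup>2) ^ (n - 2) * P_poly (n - 2) q)"
proof -
  define F where "F = (\<Sum>j\<le>Suc n. P_slice j)"
  define G where "G = (\<Sum>j\<le>n. P_slice j)"
  have F: "F $ k = P_poly k q" and G: "G $ k = P_poly k q" if "k \<le> n" for k
    unfolding F_def G_def
    by (rule P_poly_eq_sum_slices[symmetric], use that in simp)+
  have "(1 - fps_X) * (1 + fps_const (q\<^sup>2) * fps_X) * F
     = 1 + fps_const (q\<^sup>2) * fps_X - fps_const q * (fps_X * dilate (q\<^sup>2) G)
       - fps_const (q\<^sup>2) * (fps_X * (fps_X * dilate (q\<^sup>2) G))"
    unfolding F_def G_def sum_slices
    by (simp add: algebra_simps power2_eq_square flip: fps_const_mult)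
  then have "((1 - fps_X) * (1 + fps_const (q\<^sup>2) * fps_X) * F) $ n
     = (1 + fps_const (q\<^sup>2) * fps_X - fps_const q * (fps_X * dilate (q\<^sup>2) G)
       - fps_const (q\<^sup>2) * (fps_X * (fps_X * dilate (q\<^sup>2) G))) $ n"
    by (rule arg_cong)
  then show ?thesis
    unfolding quadratic_mult_nth by (auto simp: F G numeral_2_eq_2)
qed

lemma P_poly_0: "P_poly 0 q = 1"
  using P_poly_recurrence_general[of 0] by simp

lemma P_poly_1: "P_poly 1 q = - q + 1"
  using P_poly_recurrence_general[of 1] by (simp add: P_poly_0 algebra_simps)

lemma P_poly_recurrence:
  assumes "n \<ge> 2"
  shows "P_poly n q = (1 - q\<^sup>2 - q ^ (2 * n - 1)) * P_poly (n - 1) q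
                    + (q\<^sup>2 - q ^ (2 * n - 2)) * P_poly (n - 2) q"
proof -
  obtain m where n: "n = m + 2"
    using assms by (metis add.commute le_Suc_ex)
  have "q ^ (2 * n - 1) = q * (q\<^sup>2) ^ (n - 1)" "q ^ (2 * n - 2) = q\<^sup>2 * (q\<^sup>2) ^ (n - 2)"
    by (simp_all add: n flip: power_mult power_add power_Suc)
  then show ?thesis
    using P_poly_recurrence_general[of n] assms by (simp add: algebra_simps)
qed

section \<open>Alternating sums of Gaussian polynomials\<close>

definition alt_sum :: "(int \<Rightarrow> 'a) \<Rightarrow> int \<Rightarrow> int \<Rightarrow> 'a" where
  "alt_sum w M c = Sum_any (\<lambda>j::int. (-1) powi j * w j * gauss_poly q M (c - j))"

lemma alt_sum_support: "finite {j. (-1) powi j * w j * gauss_poly q M (c - j) \<noteq> 0}"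
  by (rule finite_subset[of _ "{c - M..c}"])
    (auto simp: gauss_poly_def split: if_splits)

lemma alt_sum_cmult: "alt_sum (\<lambda>j. a * w j) M c = a * alt_sum w M c"
  unfolding alt_sum_def
  by (subst Sum_any_right_distrib[OF alt_sum_support]) (simp add: mult_ac)

lemma alt_sum_Pascal:
  assumes "M \<ge> 0"
  shows "alt_sum w (M + 1) c = alt_sum w M (c - 1) + alt_sum (\<lambda>j. q powi (c - j) * w j) M c"
proof -
  have *: "gauss_poly q (M + 1) (c - j)
      = gauss_poly q M (c - 1 - j) + q powi (c - j) * gauss_poly q M (c - j)" for j
    using Pascal[OF _ assms, of "c - j"] by (simp add: algebra_simps)
  show ?thesis
    unfolding alt_sum_def
    by (subst Sum_any.distrib[symmetric, OF alt_sum_support alt_sum_support])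
      (simp only: * distrib_left mult_ac)
qed

lemma alt_sum_Pascal':
  assumes "M \<ge> 0"
  shows "alt_sum w (M + 1) c
       = alt_sum (\<lambda>j. q powi (M + 1 - c + j) * w j) M (c - 1) + alt_sum w M c"
proof -
  have *: "gauss_poly q (M + 1) (c - j)
      = q powi (M + 1 - c + j) * gauss_poly q M (c - 1 - j) + gauss_poly q M (c - j)" for j
    using Pascal'[OF _ assms, of "c - j"] by (simp add: algebra_simps)
  show ?thesis
    unfolding alt_sum_def
    by (subst Sum_any.distrib[symmetric, OF alt_sum_support alt_sum_support])
      (simp only: * distrib_left mult_ac)
qed

lemma bij_int_shift: "bij (\<lambda>j::int. j + a)" and bij_int_reflect: "bij (\<lambda>j::int. a - j)"
  by (rule bij_betw_byWitness[where f' = "\<lambda>j. j - a"]; simp)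
    (rule bij_betw_byWitness[where f' = "\<lambda>j. a - j"]; simp)

lemma alt_sum_shift:
  "alt_sum w M (c - 1) = - alt_sum (\<lambda>j. w (j - 1)) M c"
proof -
  have "alt_sum (\<lambda>j. w (j - 1)) M c
      = Sum_any (\<lambda>j::int. (-1) powi (j + 1) * w j * gauss_poly q M (c - 1 - j))"
    unfolding alt_sum_def
    by (rule Sum_any.reindex_cong[OF bij_int_shift[of 1]]) (auto simp: fun_eq_iff algebra_simps)
  also have "\<dots> = alt_sum (\<lambda>j. (-1) * w j) M (c - 1)"
    unfolding alt_sum_def by (simp add: power_int_add)
  finally show ?thesis
    unfolding alt_sum_cmult by simp
qed

lemma alt_sum_reflect: "alt_sum w M c = alt_sum (\<lambda>j. w (- j)) M (M - c)"
proof -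
  have *: "gauss_poly q M (c + j) = gauss_poly q M (M - c - j)" for j
    using gauss_poly_symmetric[of q M "c + j"] by (simp add: algebra_simps)
  show ?thesis
    unfolding alt_sum_def
    by (rule Sum_any.reindex_cong[OF bij_int_reflect[of 0]])
      (auto simp: fun_eq_iff * power_int_minus_one_minus)
qed

text \<open>
  \<open>C\<close> is the analogue of \<open>A\<close> with an odd upper entry. Pascal's rule in its two forms expresses it
  through \<open>A\<close> and through \<open>B\<close>, at the cost of the auxiliary sum \<open>X\<close> with the linear term in the
  exponent.
\<close>

abbreviation A_sum :: "nat \<Rightarrow> 'a" where
  "A_sum N \<equiv> alt_sum (\<lambda>j. q powi (j\<^sup>2)) (2 * int N) (int N)"

abbreviation B_sum :: "nat \<Rightarrow> 'a" where
  "B_sum N \<equiv> alt_sum (\<lambda>j. q powi (j\<^sup>2)) (2 * int N) (int N - 1)"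

abbreviation C_sum :: "nat \<Rightarrow> 'a" where
  "C_sum N \<equiv> alt_sum (\<lambda>j. q powi (j\<^sup>2)) (2 * int N + 1) (int N)"

abbreviation X_sum :: "nat \<Rightarrow> 'a" where
  "X_sum N \<equiv> alt_sum (\<lambda>j. q powi (j\<^sup>2 - j)) (2 * int N) (int N)"

lemma powi_mult_eq: "a + b = c + d \<Longrightarrow> q powi a * q powi b = q powi c * q powi d"
  using q_nonzero by (simp flip: power_int_add)

lemmas powi_mult_eq_power = powi_mult_eq[where c = "int n" for n, unfolded power_int_of_nat]

lemma C_eq_B_plus_X: "C_sum N = B_sum N + q ^ N * X_sum N"
proof -
  have w: "q powi (int N - j) * q powi (j\<^sup>2) = q ^ N * q powi (j\<^sup>2 - j)" for j
    by (rule powi_mult_eq_power) simp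
  show ?thesis
    using alt_sum_Pascal[of "2 * int N" "\<lambda>j. q powi (j\<^sup>2)" "int N"]
    unfolding w alt_sum_cmult by simp
qed

lemma C_eq_A_minus_X: "C_sum N = A_sum N - q ^ Suc N * X_sum N"
proof -
  have w: "q powi (2 * int N + 1 - int N + (j - 1)) * q powi ((j - 1)\<^sup>2)
      = q ^ Suc N * q powi (j\<^sup>2 - j)" for j
    by (rule powi_mult_eq_power) (simp add: power2_eq_square algebra_simps)
  show ?thesis
    using alt_sum_Pascal'[of "2 * int N" "\<lambda>j. q powi (j\<^sup>2)" "int N"]
    unfolding alt_sum_shift w alt_sum_cmult by simp
qed

text \<open>
  The reflection \<open>j \<mapsto> - 1 - j\<close> fixes \<open>j\<^sup>2 + j\<close> and the Gaussian factor and changes the sign, so the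
  sum below vanishes. The reflection is done in two steps, \<open>j \<mapsto> - j\<close> here and a shift afterwards,
  since the intermediate form is the one in which the sum appears in the step from \<open>C\<close> to \<open>A\<close>.
\<close>

lemma odd_sum_reflect:
  "alt_sum (\<lambda>j. q powi (j\<^sup>2 + j)) (2 * int N + 1) (int N)
   = alt_sum (\<lambda>j. q powi (j\<^sup>2 - j)) (2 * int N + 1) (int N + 1)"
  using alt_sum_reflect[of "\<lambda>j. q powi (j\<^sup>2 + j)" "2 * int N + 1" "int N"] by simp

lemma odd_sum_eq_0: "alt_sum (\<lambda>j. q powi (j\<^sup>2 + j)) (2 * int N + 1) (int N) = 0"
  (is "?Y = 0")
proof -
  have w: "(j - 1)\<^sup>2 + (j - 1) = j\<^sup>2 - j" for j :: int
    by (simp add: power2_eq_square algebra_simps)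
  have "?Y = - alt_sum (\<lambda>j. q powi (j\<^sup>2 - j)) (2 * int N + 1) (int N + 1)"
    using alt_sum_shift[of "\<lambda>j. q powi (j\<^sup>2 + j)" "2 * int N + 1" "int N + 1"]
    by (simp add: w)
  then have "2 * ?Y = 0"
    unfolding mult_2 by (simp flip: odd_sum_reflect)
  then show ?thesis using two_nonzero by simp
qed

text \<open>
  Expanding the vanishing odd sum by Pascal's rule leaves a relation between \<open>X\<close> and \<open>A\<close>.
\<close>

lemma X_eq_A: "X_sum N = q ^ N * A_sum N"
proof -
  have w: "q powi (2 * int N + 1 - int N + (j - 1)) * q powi ((j - 1)\<^sup>2 + (j - 1))
      = q ^ N * q powi (j\<^sup>2)" for j
    by (rule powi_mult_eq_power) (simp add: power2_eq_square algebra_simps)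
  have "alt_sum (\<lambda>j. q powi (j\<^sup>2 + j)) (2 * int N) (int N) = X_sum N"
    using alt_sum_reflect[of "\<lambda>j. q powi (j\<^sup>2 + j)" "2 * int N" "int N"] by simp
  moreover have "alt_sum (\<lambda>j. q powi (j\<^sup>2 + j)) (2 * int N + 1) (int N)
      = - (q ^ N * A_sum N) + alt_sum (\<lambda>j. q powi (j\<^sup>2 + j)) (2 * int N) (int N)"
    using alt_sum_Pascal'[of "2 * int N" "\<lambda>j. q powi (j\<^sup>2 + j)" "int N"]
    unfolding alt_sum_shift w alt_sum_cmult by simp
  ultimately show ?thesis
    by (simp add: odd_sum_eq_0)
qed

lemma A_Suc_eq_C: "A_sum (Suc N) = C_sum N"
proof -
  have w: "q powi (int N + 1 - j) * q powi (j\<^sup>2) = q ^ Suc N * q powi (j\<^sup>2 - j)" for j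
    by (rule powi_mult_eq_power) simp
  have args: "2 * int (Suc N) = 2 * int N + 1 + 1" "int (Suc N) = int N + 1"
    by simp_all
  show ?thesis
    using alt_sum_Pascal[of "2 * int N + 1" "\<lambda>j. q powi (j\<^sup>2)" "int N + 1"]
    unfolding w alt_sum_cmult args odd_sum_reflect[symmetric] odd_sum_eq_0
    by (simp add: add_ac)
qed

lemma A_Suc: "A_sum (Suc N) = (1 - q * (q\<^sup>2) ^ N) * A_sum N"
proof -
  have "q ^ Suc N * q ^ N = q * (q\<^sup>2) ^ N"
    by (simp add: power2_eq_square power_mult_distrib)
  then show ?thesis
    unfolding A_Suc_eq_C C_eq_A_minus_X X_eq_A
    by (simp only: left_diff_distrib mult_1_left mult.assoc[symmetric])
qed

text \<open>
  Replacing \<open>q\<close> by \<open>1 / q\<close> turns this into Gauss's alternating sum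
  \<open>\<Sum>\<^sub>k (-1)\<^sup>k [2N, k] = (q; q\<^sup>2)\<^sub>N\<close>.
\<close>

lemma A_eq: "A_sum N = qpoch q (q\<^sup>2) N"
proof (induction N)
  case 0
  have "gauss_poly q 0 (- j) = (if j = 0 then 1 else 0)" for j
    by (auto simp: gauss_poly_def)
  then have "A_sum 0 = Sum_any (\<lambda>j::int. if j = 0 then 1 else 0)"
    unfolding alt_sum_def by (intro Sum_any.cong) simp
  then show ?case by simp
next
  case (Suc N)
  then show ?case unfolding A_Suc qpoch_Suc by simp
qed

lemma B_eq: "B_sum N = (1 - (q\<^sup>2) ^ N - q * (q\<^sup>2) ^ N) * A_sum N"
proof -
  have "q ^ N * q ^ N = (q\<^sup>2) ^ N" by (simp add: power2_eq_square power_mult_distrib)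
  moreover have "B_sum N = (1 - q * (q\<^sup>2) ^ N) * A_sum N - q ^ N * (q ^ N * A_sum N)"
    using C_eq_B_plus_X[of N] unfolding A_Suc_eq_C[symmetric] A_Suc X_eq_A by simp
  ultimately show ?thesis by (simp add: algebra_simps flip: mult.assoc)
qed

lemma AB_eq: "A_sum N + B_sum N = (2 - (q\<^sup>2) ^ N - q * (q\<^sup>2) ^ N) * qpoch q (q\<^sup>2) N"
  unfolding B_eq A_eq by (simp add: algebra_simps)

lemma AB_0: "A_sum 0 + B_sum 0 = 1 - q"
  unfolding AB_eq by simp

section \<open>The series over the integers\<close>

definition U_series :: "nat \<Rightarrow> 'a" where
  "U_series L = Sum_any (\<lambda>j::int. (-1) powi j * q powi (j\<^sup>2) * U_poly L j q)"

lemma alt_sum_eq_sum: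
  assumes "finite I" "{c - M..c} \<subseteq> I"
  shows "alt_sum w M c = (\<Sum>j\<in>I. (-1) powi j * w j * gauss_poly q M (c - j))"
  unfolding alt_sum_def
  by (rule Sum_any.expand_superset)
    (use assms in \<open>auto simp: gauss_poly_def split: if_splits\<close>)

lemma U_series_eq_A_B:
  "U_series L = (\<Sum>r=0..L. (-1) ^ r * gauss_poly (q\<^sup>2) (int L) (int r)
                              * (A_sum (L - r) + B_sum (L - r)))"
proof -
  \<comment> \<open>The index \<open>- L - 1\<close> occurs only in the second half of \<open>U\<close>, where \<open>j\<close> is shifted by one.\<close>
  define I where "I = {- int L - 1..int L}"
  define t where "t N j = (-1) powi j * q powi (j\<^sup>2) *
    (gauss_poly q (2 * int N) (int N - j) + gauss_poly q (2 * int N) (int N - 1 - j))" for N j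
  have AB: "A_sum (L - r) + B_sum (L - r) = (\<Sum>j\<in>I. t (L - r) j)" for r
    unfolding t_def distrib_left sum.distrib
    by (intro arg_cong2[where f = "(+)"] alt_sum_eq_sum) (auto simp: I_def)
  have "U_series L = (\<Sum>j\<in>I. (-1) powi j * q powi (j\<^sup>2) * U_poly L j q)"
    unfolding U_series_def
  proof (rule Sum_any.expand_superset)
    show "{j. (-1) powi j * q powi j\<^sup>2 * U_poly L j q \<noteq> 0} \<subseteq> I"
    proof
      fix j assume "j \<in> {j. (-1) powi j * q powi j\<^sup>2 * U_poly L j q \<noteq> 0}"
      then have "T0 L j q \<noteq> 0 \<or> T0 L (j + 1) q \<noteq> 0" by (auto simp: U_poly_def)
      then show "j \<in> I"
        using T0_support[of L j q] T0_support[of L "j + 1" q] by (auto simp: I_def)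
    qed
  qed (simp add: I_def)
  also have "\<dots> = (\<Sum>j\<in>I. \<Sum>r=0..L. (-1) ^ r * gauss_poly (q\<^sup>2) (int L) (int r) * t (L - r) j)"
  proof (rule sum.cong[OF refl])
    fix j
    have "U_poly L j q = (\<Sum>r=0..L. (-1) ^ r * gauss_poly (q\<^sup>2) (int L) (int r) *
        (gauss_poly q (2 * int (L - r)) (int (L - r) - j)
         + gauss_poly q (2 * int (L - r)) (int (L - r) - 1 - j)))"
      unfolding U_poly_def T0_def sum.distrib[symmetric] distrib_left
      by (rule sum.cong[OF refl]) (simp add: of_nat_diff algebra_simps)
    then show "(-1) powi j * q powi j\<^sup>2 * U_poly L j q
        = (\<Sum>r=0..L. (-1) ^ r * gauss_poly (q\<^sup>2) (int L) (int r) * t (L - r) j)"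
      by (simp only: t_def sum_distrib_left mult_ac)
  qed
  also have "\<dots> = (\<Sum>r=0..L. (-1) ^ r * gauss_poly (q\<^sup>2) (int L) (int r)
                              * (A_sum (L - r) + B_sum (L - r)))"
    unfolding AB sum_distrib_left by (rule sum.swap)
  finally show ?thesis .
qed

text \<open>
  Dividing by \<open>(p; p)\<^sub>L\<close> turns the convolution with Gaussian coefficients in base \<open>p\<close> into an ordinary
  product. In closed form the series are \<open>sign_gf = 1 / (-x; p)\<^sub>\<infinity>\<close> and
  \<open>q3_gf = (q\<^sup>3 x; p)\<^sub>\<infinity> / (x; p)\<^sub>\<infinity>\<close>; the dilation equations below are those of these products.
\<close>

definition sign_gf :: "'a fps" where
  "sign_gf = Abs_fps (\<lambda>r. (-1) ^ r / qpoch (q\<^sup>2) (q\<^sup>2) r)"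

definition AB_gf :: "'a fps" where
  "AB_gf = Abs_fps (\<lambda>N. (A_sum N + B_sum N) / qpoch (q\<^sup>2) (q\<^sup>2) N)"

definition q3_gf :: "'a fps" where
  "q3_gf = Abs_fps (\<lambda>N. qpoch (q ^ 3) (q\<^sup>2) N / qpoch (q\<^sup>2) (q\<^sup>2) N)"

definition U_gf :: "'a fps" where
  "U_gf = Abs_fps (\<lambda>L. U_series L / qpoch (q\<^sup>2) (q\<^sup>2) L)"

lemma U_gf_eq: "U_gf = sign_gf * AB_gf"
proof (rule fps_ext)
  fix L
  have cancel: "s * (a / (b * c)) * e / a = s / b * (e / c)" if "a \<noteq> 0" for a b c e s :: 'a
    using that by simp
  have "(-1) ^ r * gauss_poly (q\<^sup>2) (int L) (int r) * (A_sum (L - r) + B_sum (L - r))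
        / qpoch (q\<^sup>2) (q\<^sup>2) L = sign_gf $ r * AB_gf $ (L - r)" if "r \<le> L" for r
    unfolding sign_gf_def AB_gf_def fps_nth_Abs_fps gauss_poly_nat[OF that]
    by (rule cancel[OF qpoch_sq_nonzero])
  then show "U_gf $ L = (sign_gf * AB_gf) $ L"
    by (simp add: U_gf_def U_series_eq_A_B fps_mult_nth sum_divide_distrib)
qed

lemma qpoch_q_Suc: "qpoch q (q\<^sup>2) (Suc N) = (1 - q) * qpoch (q ^ 3) (q\<^sup>2) N"
proof (induction N)
  case (Suc N)
  have "q * (q\<^sup>2) ^ Suc N = q ^ 3 * (q\<^sup>2) ^ N"
    by (simp add: power2_eq_square power3_eq_cube)
  then show ?case
    unfolding qpoch_Suc[of _ _ "Suc N"] Suc.IH by (simp add: qpoch_Suc)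
qed (simp add: qpoch_Suc)

lemma one_minus_sq_nonzero: "1 - q\<^sup>2 * (q\<^sup>2) ^ n \<noteq> 0"
  using not_root_of_unity_sq[of "Suc n"] by simp

lemma AB_gf_eq: "AB_gf = fps_const (1 - q) * ((1 + fps_X) * q3_gf)"
proof (rule fps_ext)
  fix n
  show "AB_gf $ n = (fps_const (1 - q) * ((1 + fps_X) * q3_gf)) $ n"
  proof (cases n)
    case 0
    show ?thesis
      unfolding 0 using AB_0 by (simp add: AB_gf_def q3_gf_def distrib_right)
  next
    case (Suc m)
    have "A_sum (Suc m) + B_sum (Suc m)
        = (2 - (q\<^sup>2) ^ Suc m - q * (q\<^sup>2) ^ Suc m) * ((1 - q) * qpoch (q ^ 3) (q\<^sup>2) m)"
      unfolding AB_eq qpoch_q_Suc ..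
    also have "\<dots> = (1 - q) * qpoch (q ^ 3) (q\<^sup>2) m *
        ((1 - q ^ 3 * (q\<^sup>2) ^ m) + (1 - q\<^sup>2 * (q\<^sup>2) ^ m))"
      by (simp add: algebra_simps power2_eq_square power3_eq_cube)
    finally have "A_sum (Suc m) + B_sum (Suc m) = \<dots>" .
    then show ?thesis
      using one_minus_sq_nonzero[of m] qpoch_sq_nonzero[of m] Suc
      unfolding AB_gf_def q3_gf_def fps_mult_left_const_nth distrib_right fps_add_nth mult_1
        fps_X_mult_nth fps_nth_Abs_fps Suc qpoch_Suc
      by (simp add: divide_simps) (simp add: algebra_simps)
  qed
qed

lemma sign_gf_dilate: "(1 + fps_X) * sign_gf = dilate (q\<^sup>2) sign_gf"
proof (rule fps_ext)
  fix n
  show "((1 + fps_X) * sign_gf) $ n = dilate (q\<^sup>2) sign_gf $ n"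
    using one_minus_sq_nonzero qpoch_sq_nonzero
    by (cases n)
      (auto simp: sign_gf_def distrib_right qpoch_Suc divide_simps, simp_all add: algebra_simps)
qed

lemma q3_gf_dilate:
  "(1 - fps_X) * q3_gf = (1 - fps_const (q ^ 3) * fps_X) * dilate (q\<^sup>2) q3_gf"
proof (rule fps_ext)
  fix n
  show "((1 - fps_X) * q3_gf) $ n = ((1 - fps_const (q ^ 3) * fps_X) * dilate (q\<^sup>2) q3_gf) $ n"
    using one_minus_sq_nonzero qpoch_sq_nonzero
    by (cases n)
      (auto simp: q3_gf_def left_diff_distrib mult.assoc qpoch_Suc divide_simps,
       simp_all add: algebra_simps)
qed

text \<open>
  The factor \<open>1 + x\<close> of \<open>AB_gf\<close> is what dilates \<open>sign_gf\<close>, and its own dilation \<open>1 + p x\<close>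
  appears on the left-hand side.
\<close>

lemma U_gf_dilate:
  "(1 - fps_X) * (1 + fps_const (q\<^sup>2) * fps_X) * U_gf
   = (1 - fps_const (q ^ 3) * fps_X) * dilate (q\<^sup>2) U_gf"
proof -
  have d1: "dilate (q\<^sup>2) (1 + fps_X) = 1 + fps_const (q\<^sup>2) * fps_X"
    by (simp add: dilate_def fps_compose_add_distrib)
  have "(1 - fps_X) * (1 + fps_const (q\<^sup>2) * fps_X) * U_gf
     = fps_const (1 - q) * ((1 + fps_const (q\<^sup>2) * fps_X) * (((1 + fps_X) * sign_gf) * ((1 - fps_X) * q3_gf)))"
    unfolding U_gf_eq AB_gf_eq by (simp only: mult_ac)
  also have "\<dots> = (1 - fps_const (q ^ 3) * fps_X) * dilate (q\<^sup>2) U_gf"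
    unfolding sign_gf_dilate q3_gf_dilate U_gf_eq AB_gf_eq dilate_mult dilate_const d1
    by (simp only: mult_ac)
  finally show ?thesis .
qed

lemma U_series_0: "U_series 0 = 1 - q"
  using AB_0 by (simp add: U_series_eq_A_B gauss_poly_0_right[OF not_root_of_unity_sq])

lemma U_series_Suc:
  "U_series (Suc m) = (1 - q\<^sup>2 - q ^ 3 * (q\<^sup>2) ^ m) * U_series m
     + (if m = 0 then 0 else q\<^sup>2 * (1 - (q\<^sup>2) ^ m) * U_series (m - 1))"
proof -
  have "(1 - fps_X) * (1 + fps_const (q\<^sup>2) * fps_X) * U_gf
      = dilate (q\<^sup>2) U_gf - fps_const (q ^ 3) * (fps_X * dilate (q\<^sup>2) U_gf)"
    unfolding U_gf_dilate by (simp add: left_diff_distrib mult.assoc)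
  then have "((1 - fps_X) * (1 + fps_const (q\<^sup>2) * fps_X) * U_gf) $ Suc m
      = (dilate (q\<^sup>2) U_gf - fps_const (q ^ 3) * (fps_X * dilate (q\<^sup>2) U_gf)) $ Suc m"
    by (rule arg_cong)
  then have eq: "U_gf $ Suc m - (1 - q\<^sup>2) * U_gf $ m - (if m = 0 then 0 else q\<^sup>2 * U_gf $ (m - 1))
      = (q\<^sup>2) ^ Suc m * U_gf $ Suc m - q ^ 3 * (q\<^sup>2) ^ m * U_gf $ m"
    unfolding quadratic_mult_nth
    by (cases "m = 0") (simp_all add: Suc_diff_le numeral_2_eq_2 mult.assoc)
  define d where "d = qpoch (q\<^sup>2) (q\<^sup>2) m"
  have d: "d \<noteq> 0"
    unfolding d_def by (rule qpoch_sq_nonzero)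
  have cancel: "s = (s / (e * a) - b * (s / (e * a))) * e" if "a = 1 - b" "a \<noteq> 0" "e \<noteq> 0"
    for a b e s :: 'a
  proof -
    have "(s / (e * a) - b * (s / (e * a))) * e = s / (e * a) * (1 - b) * e"
      by (simp only: left_diff_distrib right_diff_distrib mult_1_left mult_1_right mult_ac)
    then show ?thesis using that by simp
  qed
  have next_coeff: "U_series (Suc m) = (U_gf $ Suc m - (q\<^sup>2) ^ Suc m * U_gf $ Suc m) * d"
    unfolding U_gf_def fps_nth_Abs_fps qpoch_Suc d_def[symmetric]
    by (rule cancel[OF _ one_minus_sq_nonzero d]) simp
  have this_coeff: "U_gf $ m * d = U_series m"
    using d by (simp add: U_gf_def d_def)
  have prev_coeff: "U_gf $ (m - 1) * d = (1 - (q\<^sup>2) ^ m) * U_series (m - 1)" if "m \<noteq> 0"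
    using that d unfolding d_def by (cases m) (auto simp: U_gf_def qpoch_Suc)
  have rearrange: "a - b = (1 - r - s) * c + t" if "a - (1 - r) * c - t = b - s * c"
    for a b c r s t :: 'a
  proof -
    have "a = (1 - r) * c + t + b - s * c"
      using that by (simp add: diff_eq_eq algebra_simps)
    then show ?thesis by (simp add: algebra_simps)
  qed
  have "U_gf $ Suc m - (q\<^sup>2) ^ Suc m * U_gf $ Suc m
      = (1 - q\<^sup>2 - q ^ 3 * (q\<^sup>2) ^ m) * U_gf $ m + (if m = 0 then 0 else q\<^sup>2 * U_gf $ (m - 1))"
    by (rule rearrange[OF eq])
  then show ?thesis
    unfolding next_coeff using this_coeff prev_coeff
    by (cases "m = 0") (simp_all add: distrib_right mult.assoc)
qed

text \<open>
  The recurrence for \<open>P\<^sub>2\<close> involves \<open>P\<^sub>0\<close>, which has no counterpart in \<open>U_series\<close>; its coefficient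
  there is \<open>q\<^sup>2 - q\<^sup>2 = 0\<close>.
\<close>

lemma P_poly_Suc: "P_poly (Suc n) q = U_series n"
proof (induction n rule: less_induct)
  case (less n)
  show ?case
  proof (cases n)
    case 0
    then show ?thesis using P_poly_1 U_series_0 by simp
  next
    case (Suc m)
    have e: "q ^ (2 * Suc (Suc m) - 1) = q ^ 3 * (q\<^sup>2) ^ m" "q ^ (2 * Suc (Suc m) - 2) = q\<^sup>2 * (q\<^sup>2) ^ m"
      by (simp_all add: numeral_eq_Suc flip: power_mult power_add power_Suc)
    have "P_poly (Suc n) q = (1 - q\<^sup>2 - q ^ 3 * (q\<^sup>2) ^ m) * U_series m + (q\<^sup>2 - q\<^sup>2 * (q\<^sup>2) ^ m) * P_poly m q"
      using P_poly_recurrence[of "Suc (Suc m)"] less[of m] unfolding Suc e by simp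
    then show ?thesis
      using less[of "m - 1"] Suc by (cases m) (simp_all add: U_series_Suc algebra_simps)
  qed
qed

end

lemma qvar_nonzero: "qvar \<noteq> 0"
  by (simp add: qvar_def eq_fract Zero_fract_def)

lemma two_fract_nonzero: "(2 :: int poly fract) \<noteq> 0"
proof -
  have "(2 :: int poly fract) = Fract 1 1 + Fract 1 1"
    unfolding One_fract_def[symmetric] by simp
  also have "\<dots> = Fract 2 1"
    by simp
  finally have "(2 :: int poly fract) = Fract 2 1" .
  moreover have "Fract 2 1 \<noteq> (0 :: int poly fract)"
    by (simp add: eq_fract Zero_fract_def)
  ultimately show ?thesis by simp
qed

theorem mainTheorem3:
  shows "(\<forall>n\<ge>1. P_poly n qvar =
            Sum_any (\<lambda>j::int. (-1) powi j * qvar powi (j\<^sup>2) * U_poly (n - 1) j qvar))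
       \<and> P_poly 0 qvar = 1
       \<and> P_poly 1 qvar = - qvar + 1
       \<and> (\<forall>n\<ge>2. P_poly n qvar = (1 - qvar\<^sup>2 - qvar ^ (2 * n - 1)) * P_poly (n - 1) qvar
                     + (qvar\<^sup>2 - qvar ^ (2 * n - 2)) * P_poly (n - 2) qvar)"
proof -
  interpret generic_q qvar
    by standard (use qvar_nonzero qvar_power_neq_1 two_fract_nonzero in auto)
  have "P_poly n qvar = U_series (n - 1)" if "n \<ge> 1" for n
    using P_poly_Suc[of "n - 1"] that by simp
  then show ?thesis
    using P_poly_0 P_poly_1 P_poly_recurrence unfolding U_series_def by blast
qed

end
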